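(* Let $M$ be a matroid on an $n$-element set and let $x$ be an element not in that set. The $\mathcal{G}$-invariant of the free extension $M+x$ is obtained from $\mathcal{G}(M)$ by the specialization $$[r_1r_2\ldots r_n]\mapsto[1r_1r_2\ldots r_n]^{\downarrow}+\sum_{j=1}^n[r_1\ldots r_j\,1\,r_{j+1}\ldots r_n]^{\downarrow},$$ and the $\mathcal{G}$-invariant of the free coextension $M\times x$ is obtained from $\mathcal{G}(M)$ by the specialization $$[r_1r_2\ldots r_n]\mapsto[0r_1r_2\ldots r_n]^{\uparrow}+\sum_{j=1}^n[r_1\ldots r_j\,0\,r_{j+1}\ldots r_n]^{\uparrow}.$$
   Context: An $(n,r)$-sequence is a $0,1$-sequence of length $n$ with exactly $r$ ones. $\mathcal{G}(n,r)$ is the vector space over a field of characteristic zero with basis the formal symbols $[\underline{r}]$, one for each $(n,r)$-sequence $\underline{r}$. For a rank-$r$ matroid $M$ with rank function $r(\cdot)$ on an $n$-element set $E$, and a permutation (linear ordering) $\pi$ of $E$, the rank sequence $\underline{r}(\pi)=r_1r_2\ldots r_n$ is given by $r_1=r(\{\pi(1)\})$ and $r_j=r(\{\pi(1),\ldots,\pi(j)\})-r(\{\pi(1),\ldots,\pi(j-1)\})$ for $j\ge2$. The $\mathcal{G}$-invariant is $\mathcal{G}(M)=\sum_{\pi}[\underline{r}(\pi)]\in\mathcal{G}(n,r)$, the sum over all $n!$ permutations of $E$. A specialization is an assignment of a value to each symbol $[\underline{r}]$, extended linearly to $\mathcal{G}(n,r)$; "obtained by the specialization" means applying this linear map to $\mathcal{G}(M)$.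 For a symbol $[\underline{s}]$, $[\underline{s}]^{\downarrow}$ is the symbol of the sequence obtained from $\underline{s}$ by replacing its right-most $1$ by $0$, and $[\underline{s}]^{\uparrow}$ is the symbol of the sequence obtained by replacing its left-most $0$ by $1$. The free extension $M+x$ is the matroid on $E(M)\cup\{x\}$ whose bases are the bases of $M$ together with the sets $B\cup\{x\}$ where $B$ is a basis of a copoint (flat of rank $r(M)-1$) of $M$. The free coextension is $M\times x=(M^*+x)^*$, where $^*$ is matroid duality. *)

theory Defs
  imports
    Complex_Main
    "HOL-Library.Poly_Mapping"
    "HOL-Combinatorics.Multiset_Permutations"
begin

record 'a matroid_struct =
  ground :: "'a set"
  bases :: "'a set set"

locale matroid =
  fixes M :: "'a matroid_struct"
  assumes finite_ground: "finite (ground M)"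
    and bases_subset: "B \<in> bases M \<Longrightarrow> B \<subseteq> ground M"
    and bases_nonempty: "bases M \<noteq> {}"
    and bases_exchange:
      "\<lbrakk>B \<in> bases M; B' \<in> bases M; e \<in> B - B'\<rbrakk>
        \<Longrightarrow> \<exists>f \<in> B' - B. insert f (B - {e}) \<in> bases M"

definition indep :: "'a matroid_struct \<Rightarrow> 'a set \<Rightarrow> bool" where
  "indep M I \<longleftrightarrow> (\<exists>B \<in> bases M. I \<subseteq> B)"

definition rank :: "'a matroid_struct \<Rightarrow> 'a set \<Rightarrow> nat" where
  "rank M A = Max {card I |I. I \<subseteq> A \<and> indep M I}"

definition flat :: "'a matroid_struct \<Rightarrow> 'a set \<Rightarrow> bool" where
  "flat M F \<longleftrightarrow> F \<subseteq> ground M \<and> (\<forall>e \<in> ground M - F. rank M F < rank M (insert e F))"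

text \<open>A matroid of rank 0 has no copoints.\<close>

definition copoint :: "'a matroid_struct \<Rightarrow> 'a set \<Rightarrow> bool" where
  "copoint M F \<longleftrightarrow> flat M F \<and> rank M F + 1 = rank M (ground M)"

definition basis_of :: "'a matroid_struct \<Rightarrow> 'a set \<Rightarrow> 'a set \<Rightarrow> bool" where
  "basis_of M A B \<longleftrightarrow>
     B \<subseteq> A \<and> indep M B \<and> (\<forall>I. I \<subseteq> A \<and> indep M I \<and> B \<subseteq> I \<longrightarrow> I = B)"

definition dual :: "'a matroid_struct \<Rightarrow> 'a matroid_struct" where
  "dual M = \<lparr>ground = ground M, bases = {ground M - B |B. B \<in> bases M}\<rparr>"

definition free_extension :: "'a matroid_struct \<Rightarrow> 'a \<Rightarrow> 'a matroid_struct" where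
  "free_extension M x =
     \<lparr>ground = insert x (ground M),
      bases = bases M \<union> {insert x B |B F. copoint M F \<and> basis_of M F B}\<rparr>"

definition free_coextension :: "'a matroid_struct \<Rightarrow> 'a \<Rightarrow> 'a matroid_struct" where
  "free_coextension M x = dual (free_extension (dual M) x)"


definition nr_sequences :: "nat \<Rightarrow> nat \<Rightarrow> nat list set" where
  "nr_sequences n r = {s. length s = n \<and> set s \<subseteq> {0, 1} \<and> count_list s 1 = r}"

text \<open>
  All the spaces \<open>\<G>(n,r)\<close> are regarded as subspaces of one space, the finitely supported
  functions from sequences to scalars, in which the symbol of a sequence is its unit vector.
\<close>

definition scale :: "'k::field_char_0 \<Rightarrow> (nat list \<Rightarrow>\<^sub>0 'k) \<Rightarrow> (nat list \<Rightarrow>\<^sub>0 'k)" where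
  "scale c p = Poly_Mapping.map ((*) c) p"

definition symbol :: "nat list \<Rightarrow> (nat list \<Rightarrow>\<^sub>0 'k::field_char_0)" where
  "symbol s = Poly_Mapping.single s 1"

lemma lookup_scale: "Poly_Mapping.lookup (scale c p) s = c * Poly_Mapping.lookup p s"
  unfolding scale_def by (simp add: Poly_Mapping.map.rep_eq when_def)

interpretation symbols: vector_space "scale :: 'k::field_char_0 \<Rightarrow> _"
  by standard (auto intro!: poly_mapping_eqI simp: lookup_scale lookup_add algebra_simps)

definition G_space :: "nat \<Rightarrow> nat \<Rightarrow> (nat list \<Rightarrow>\<^sub>0 'k::field_char_0) set" where
  "G_space n r = symbols.span (symbol ` nr_sequences n r)"

text \<open>The first entry is the rank of the first element, since the empty set has rank 0.\<close>

definition rank_sequence :: "'a matroid_struct \<Rightarrow> 'a list \<Rightarrow> nat list" where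
  "rank_sequence M \<pi> =
     map (\<lambda>j. rank M (set (take (Suc j) \<pi>)) - rank M (set (take j \<pi>))) [0..<length \<pi>]"

definition G_invariant :: "'a matroid_struct \<Rightarrow> (nat list \<Rightarrow>\<^sub>0 'k::field_char_0)" where
  "G_invariant M = (\<Sum>\<pi> \<in> permutations_of_set (ground M). symbol (rank_sequence M \<pi>))"

definition specialize ::
    "(nat list \<Rightarrow> (nat list \<Rightarrow>\<^sub>0 'k)) \<Rightarrow> (nat list \<Rightarrow>\<^sub>0 'k) \<Rightarrow> (nat list \<Rightarrow>\<^sub>0 'k::field_char_0)" where
  "specialize f p = (\<Sum>s \<in> Poly_Mapping.keys p. scale (Poly_Mapping.lookup p s) (f s))"

text \<open>These are only meaningful if the entry to be replaced exists.\<close>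

definition lower :: "nat list \<Rightarrow> nat list" where
  "lower s = s[Max {i. i < length s \<and> s ! i = 1} := 0]"

definition raise :: "nat list \<Rightarrow> nat list" where
  "raise s = s[Min {i. i < length s \<and> s ! i = 0} := 1]"

text \<open>\<open>insert_after j a s\<close> is \<open>s\<^sub>1 \<dots> s\<^sub>j a s\<^sub>j\<^sub>+\<^sub>1 \<dots> s\<^sub>n\<close>.\<close>

definition insert_after :: "nat \<Rightarrow> nat \<Rightarrow> nat list \<Rightarrow> nat list" where
  "insert_after j a s = take j s @ a # drop j s"


lemma lookup_symbol: "Poly_Mapping.lookup (symbol s) t = (if s = t then 1 else 0)"
  by (simp add: symbol_def lookup_single when_def)

lemma specialize_superset:
  assumes "finite S" "Poly_Mapping.keys p \<subseteq> S"
  shows "specialize f p = (\<Sum>s \<in> S. scale (Poly_Mapping.lookup p s) (f s))"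
  unfolding specialize_def
  by (rule sum.mono_neutral_left)
    (use assms in \<open>auto simp: in_keys_iff intro!: poly_mapping_eqI simp: lookup_scale\<close>)

lemma specialize_symbol: "specialize f (symbol s) = f s"
proof -
  have "Poly_Mapping.keys (symbol s :: nat list \<Rightarrow>\<^sub>0 'a) = {s}"
    by (simp add: symbol_def)
  then show ?thesis
    by (simp add: specialize_def lookup_symbol)
qed

lemma linear_specialize: "Vector_Spaces.linear scale scale (specialize f)"
proof
  fix p q :: "nat list \<Rightarrow>\<^sub>0 'a" and c :: 'a
  let ?S = "Poly_Mapping.keys p \<union> Poly_Mapping.keys q"
  have sub: "Poly_Mapping.keys (p + q) \<subseteq> ?S"
    by (rule Poly_Mapping.keys_add)
  show "specialize f (p + q) = specialize f p + specialize f q"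
    using sub
    by (simp add: specialize_superset[of ?S] lookup_add symbols.scale_left_distrib sum.distrib)
  have "Poly_Mapping.keys (scale c p) \<subseteq> Poly_Mapping.keys p"
    by (auto simp: in_keys_iff lookup_scale)
  then show "specialize f (scale c p) = scale c (specialize f p)"
    by (simp add: specialize_superset[of "Poly_Mapping.keys p"] lookup_scale symbols.scale_sum_right)
qed

lemma independent_symbols: "\<not> symbols.dependent (symbol ` S)"
proof -
  have inj: "inj (symbol :: nat list \<Rightarrow> (nat list \<Rightarrow>\<^sub>0 'a))"
    by (rule injI) (metis lookup_symbol zero_neq_one)
  show ?thesis
    unfolding symbols.independent_explicit_module
  proof (intro allI impI)
    fix T u and v :: "nat list \<Rightarrow>\<^sub>0 'a"
    assume T: "finite T" "T \<subseteq> symbol ` S" "(\<Sum>v\<in>T. scale (u v) v) = 0" "v \<in> T"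
    then obtain s where s: "v = symbol s" by auto
    have "0 = Poly_Mapping.lookup (\<Sum>v\<in>T. scale (u v) v) s" using T by simp
    also have "\<dots> = (\<Sum>w\<in>T. if w = v then u v else 0)"
      unfolding lookup_sum lookup_scale
      by (rule sum.cong) (use T(2) s inj in \<open>auto simp: lookup_symbol inj_eq\<close>)
    also have "\<dots> = u v" using T by simp
    finally show "u v = 0" by simp
  qed
qed

context matroid
begin

lemma indep_subset_ground: "indep M I \<Longrightarrow> I \<subseteq> ground M"
  using bases_subset by (auto simp: indep_def)

lemma indep_empty: "indep M {}"
  using bases_nonempty by (auto simp: indep_def)

lemma finite_indep_cards: "finite {card I |I. I \<subseteq> A \<and> indep M I}"
proof -
  have "{card I |I. I \<subseteq> A \<and> indep M I} \<subseteq> card ` Pow (ground M)"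
    using indep_subset_ground by auto
  then show ?thesis
    using finite_ground finite_subset by blast
qed

lemma card_le_rank: "I \<subseteq> A \<Longrightarrow> indep M I \<Longrightarrow> card I \<le> rank M A"
  unfolding rank_def by (rule Max_ge[OF finite_indep_cards]) auto

lemma rank_witness: "\<exists>I. I \<subseteq> A \<and> indep M I \<and> rank M A = card I"
proof -
  have "rank M A \<in> {card I |I. I \<subseteq> A \<and> indep M I}"
    unfolding rank_def by (rule Max_in[OF finite_indep_cards]) (use indep_empty in auto)
  then show ?thesis by auto
qed

lemma rank_empty: "rank M {} = 0"
  using rank_witness[of "{}"] by auto

lemma rank_mono: "A \<subseteq> A' \<Longrightarrow> rank M A \<le> rank M A'"
  by (metis card_le_rank order_trans rank_witness)

lemma rank_insert_le: "rank M (insert e A) \<le> rank M A + 1"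
proof -
  obtain I where I: "I \<subseteq> insert e A" "indep M I" "rank M (insert e A) = card I"
    using rank_witness by blast
  have "indep M (I - {e})"
    using I(2) by (auto simp: indep_def)
  then have "card (I - {e}) \<le> rank M A"
    using I(1) by (intro card_le_rank) auto
  moreover have "card I \<le> card (I - {e}) + 1"
    unfolding card_Diff_singleton_if by (split if_split) linarith
  ultimately show ?thesis
    using I(3) by linarith
qed

lemma rank_sequence_in_nr_sequences:
  assumes "\<pi> \<in> permutations_of_set (ground M)"
  shows "rank_sequence M \<pi> \<in> nr_sequences (card (ground M)) (rank M (ground M))"
proof -
  have \<pi>: "set \<pi> = ground M" "distinct \<pi>"
    using assms by (auto simp: permutations_of_set_def)
  define R where "R j = rank M (set (take j \<pi>))" for j
  have step: "R j \<le> R (Suc j) \<and> R (Suc j) \<le> R j + 1" if "j < length \<pi>" for j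
    using that rank_insert_le[of "\<pi> ! j" "set (take j \<pi>)"]
      rank_mono[of "set (take j \<pi>)" "insert (\<pi> ! j) (set (take j \<pi>))"]
    by (auto simp: R_def take_Suc_conv_app_nth)
  have count: "count_list (map (\<lambda>j. R (Suc j) - R j) [0..<m]) 1 = R m" if "m \<le> length \<pi>" for m
    using that
  proof (induction m)
    case 0
    then show ?case by (simp add: R_def rank_empty)
  next
    case (Suc m)
    then show ?case using step[of m] by auto
  qed
  have seq: "rank_sequence M \<pi> = map (\<lambda>j. R (Suc j) - R j) [0..<length \<pi>]"
    by (simp add: rank_sequence_def R_def)
  have "set (rank_sequence M \<pi>) \<subseteq> {0, 1}"
    using step by (force simp: seq)
  moreover have "length (rank_sequence M \<pi>) = card (ground M)"
    using \<pi> distinct_card by (fastforce simp: seq)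
  moreover have "count_list (rank_sequence M \<pi>) 1 = rank M (ground M)"
    using count[of "length \<pi>"] \<pi> by (simp add: seq R_def)
  ultimately show ?thesis
    by (simp add: nr_sequences_def)
qed

lemma G_invariant_in_G_space: "G_invariant M \<in> G_space (card (ground M)) (rank M (ground M))"
  unfolding G_invariant_def G_space_def
  by (intro symbols.span_sum symbols.span_base imageI rank_sequence_in_nr_sequences)

end

end

theory Submission
  imports Defs
begin

text \<open>
  Adding \<open>x\<close> freely gives \<open>r(A \<union> {x}) = min (r(A) + 1) (r(E))\<close>. So when \<open>x\<close> is inserted into an
  ordering of \<open>E\<close>, the rank sequence gains a \<open>1\<close> at the place of \<open>x\<close>, except that the partial sums
  are truncated at \<open>r(E)\<close>; truncating them is the same as deleting the right-most \<open>1\<close>.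
  The formula for the free coextension follows by duality, because dualizing a matroid and reversing
  the ordering reverses the rank sequence and exchanges zeros and ones.
\<close>

section \<open>Independence, duality and rank\<close>

context matroid
begin

lemma finite_indep: "indep M I \<Longrightarrow> finite I"
  using indep_subset_ground finite_ground finite_subset by blast

lemma indep_subset: "indep M I \<Longrightarrow> J \<subseteq> I \<Longrightarrow> indep M J"
  unfolding indep_def by blast

lemma indep_base: "B \<in> bases M \<Longrightarrow> indep M B"
  unfolding indep_def by blast

lemma finite_base: "B \<in> bases M \<Longrightarrow> finite B"
  using finite_indep indep_base by blast

text \<open>Each exchange keeps the size of \<open>B\<close> and brings it closer to
  \<open>B'\<close>, whence the induction on \<open>card (B - B')\<close>. When nothing is left to
  exchange, the axiom with the roles swapped leaves no element of \<open>B' - B\<close>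
  either.\<close>

lemma bases_card_eq:
  assumes "B \<in> bases M" "B' \<in> bases M"
  shows "card B = card B'"
  using assms(1)
proof (induction "card (B - B')" arbitrary: B rule: less_induct)
  case less
  have fin: "finite B" "finite B'"
    using finite_base less.prems assms(2) by auto
  show ?case
  proof (cases "B - B' = {}")
    case True
    then have "B' - B = {}"
      using bases_exchange[OF assms(2) less.prems] by blast
    with True have "B = B'" by blast
    then show ?thesis by simp
  next
    case False
    then obtain e where e: "e \<in> B - B'" by blast
    obtain f where f: "f \<in> B' - B" "insert f (B - {e}) \<in> bases M"
      using bases_exchange[OF less.prems assms(2) e] by blast
    have "insert f (B - {e}) - B' \<subset> B - B'"
      using e f(1) by auto
    then have "card (insert f (B - {e}) - B') < card (B - B')"
      using fin by (intro psubset_card_mono) auto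
    then have "card (insert f (B - {e})) = card B'"
      using less.hyps f(2) by blast
    moreover have "card (insert f (B - {e})) = card B"
      using e f(1) fin card_Suc_Diff1[of B e] by simp
    ultimately show ?thesis by simp
  qed
qed

lemma rank_ground:
  assumes "B \<in> bases M"
  shows "rank M (ground M) = card B"
proof (rule antisym)
  obtain I where I: "indep M I" "rank M (ground M) = card I"
    using rank_witness by blast
  then obtain B' where "B' \<in> bases M" "I \<subseteq> B'"
    unfolding indep_def by blast
  then show "rank M (ground M) \<le> card B"
    using I bases_card_eq[OF assms] card_mono[OF finite_base] by fastforce
  show "card B \<le> rank M (ground M)"
    using assms bases_subset indep_base card_le_rank by blast
qed

lemma indep_card_rank_base:
  assumes "indep M I" "card I = rank M (ground M)"
  shows "I \<in> bases M"
proof -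
  obtain B where B: "B \<in> bases M" "I \<subseteq> B"
    using assms(1) unfolding indep_def by blast
  then have "I = B"
    using assms(2) rank_ground finite_base by (intro card_subset_eq) auto
  with B show ?thesis by simp
qed

lemma indep_card_le: "indep M I \<Longrightarrow> card I \<le> rank M (ground M)"
  using card_le_rank indep_subset_ground by blast

text \<open>Once \<open>I\<close> lies in a base \<open>B\<close> contained in
  \<open>B' \<union> I\<close>, some element of \<open>B\<close> must come from
  \<open>J - I\<close>: otherwise \<open>B - I\<close> would fit into \<open>B' - J\<close>, which
  is too small because all bases have the same size.\<close>

lemma indep_augment:
  assumes I: "indep M I" and J: "indep M J" and less: "card I < card J"
  shows "\<exists>e \<in> J - I. indep M (insert e I)"
proof -
  obtain B' where B': "B' \<in> bases M" "J \<subseteq> B'"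
    using J unfolding indep_def by blast
  \<comment> \<open>Choosing the base \<open>B \<supseteq> I\<close> with \<open>B - (B' \<union> I)\<close> minimal forces \<open>B \<subseteq> B' \<union> I\<close>.\<close>
  obtain B\<^sub>0 where "B\<^sub>0 \<in> bases M \<and> I \<subseteq> B\<^sub>0"
    using I unfolding indep_def by blast
  then obtain B where B: "B \<in> bases M" "I \<subseteq> B"
    and min: "\<And>C. C \<in> bases M \<Longrightarrow> I \<subseteq> C \<Longrightarrow> card (B - (B' \<union> I)) \<le> card (C - (B' \<union> I))"
    using ex_has_least_nat[of "\<lambda>B. B \<in> bases M \<and> I \<subseteq> B" B\<^sub>0 "\<lambda>B. card (B - (B' \<union> I))"]
    by auto
  have sub: "B \<subseteq> B' \<union> I"
  proof (rule ccontr)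
    assume "\<not> B \<subseteq> B' \<union> I"
    then obtain e where e: "e \<in> B - B'" "e \<notin> I" by blast
    obtain f where f: "f \<in> B' - B" "insert f (B - {e}) \<in> bases M"
      using bases_exchange[OF B(1) B'(1) e(1)] by blast
    have "insert f (B - {e}) - (B' \<union> I) \<subset> B - (B' \<union> I)"
      using e f(1) by auto
    then have "card (insert f (B - {e}) - (B' \<union> I)) < card (B - (B' \<union> I))"
      using finite_base[OF B(1)] by (intro psubset_card_mono) auto
    with min[OF f(2)] B(2) e(2) show False by fastforce
  qed
  have "B \<inter> (J - I) \<noteq> {}"
  proof
    assume "B \<inter> (J - I) = {}"
    then have "B - I \<subseteq> B' - J" using sub by blast
    then have "card (B - I) \<le> card (B' - J)"
      using finite_base[OF B'(1)] by (intro card_mono) auto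
    then have "card B - card I \<le> card B' - card J"
      using B B' I J by (simp add: card_Diff_subset finite_indep)
    \<comment> \<open>Subtraction on naturals is truncated, so this bound is needed to read the
      preceding inequality as \<open>card J \<le> card I\<close>.\<close>
    moreover have "card J \<le> card B'"
      using B' finite_base card_mono by blast
    ultimately show False
      using less bases_card_eq[OF B(1) B'(1)] by linarith
  qed
  then obtain e where "e \<in> B" "e \<in> J - I" by blast
  then show ?thesis
    using B unfolding indep_def by blast
qed

text \<open>\<open>basis_of\<close> asks for maximality under inclusion, \<open>rank\<close> for
  maximal size; augmentation inside \<open>A\<close> makes the two agree.\<close>

lemma basis_of_card:
  assumes "basis_of M A B"
  shows "card B = rank M A"
proof (rule antisym)
  show "card B \<le> rank M A"
    using assms card_le_rank unfolding basis_of_def by blast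
  show "rank M A \<le> card B"
  proof (rule ccontr)
    assume "\<not> rank M A \<le> card B"
    then obtain J where J: "J \<subseteq> A" "indep M J" "card B < card J"
      using rank_witness[of A] by auto
    then obtain e where "e \<in> J - B" "indep M (insert e B)"
      using indep_augment[of B J] assms unfolding basis_of_def by blast
    then show False
      using assms J(1) unfolding basis_of_def by blast
  qed
qed

lemma indep_extend_basis_of:
  assumes "I \<subseteq> A" "indep M I"
  shows "\<exists>B. basis_of M A B \<and> I \<subseteq> B"
proof -
  let ?S = "{J. I \<subseteq> J \<and> J \<subseteq> A \<and> indep M J}"
  have "?S \<subseteq> Pow (ground M)"
    using indep_subset_ground by blast
  then have "finite ?S"
    using finite_ground by (simp add: finite_subset)
  moreover have "?S \<noteq> {}" using assms by blast
  ultimately obtain B where "B \<in> ?S" "\<forall>J \<in> ?S. B \<subseteq> J \<longrightarrow> B = J"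
    using finite_has_maximal[of ?S] by blast
  then have "basis_of M A B \<and> I \<subseteq> B"
    unfolding basis_of_def by (metis (mono_tags, lifting) mem_Collect_eq order_trans)
  then show ?thesis by blast
qed

section \<open>The dual matroid and its rank function\<close>

lemma ground_dual [simp]: "ground (dual M) = ground M"
  by (simp add: dual_def)

lemma bases_dual: "bases (dual M) = (\<lambda>B. ground M - B) ` bases M"
  by (auto simp: dual_def)

text \<open>This is the exchange axiom for complements of bases: the entering element is prescribed
  and the leaving one is found. Extending \<open>insert e (B \<inter> B')\<close> inside
  \<open>insert e B\<close> to a set of size \<open>card B\<close> omits exactly one element, and
  that element cannot lie in \<open>B'\<close>.\<close>

lemma bases_exchange_dual:
  assumes B: "B \<in> bases M" and B': "B' \<in> bases M" and e: "e \<in> B' - B"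
  shows "\<exists>f \<in> B - B'. insert e (B - {f}) \<in> bases M"
proof -
  have "indep M (insert e (B \<inter> B'))"
    using e by (intro indep_subset[OF indep_base[OF B']]) auto
  then obtain C where C: "basis_of M (insert e B) C" "insert e (B \<inter> B') \<subseteq> C"
    using indep_extend_basis_of[of "insert e (B \<inter> B')" "insert e B"] by blast
  have CB: "C \<subseteq> insert e B" "indep M C"
    using C(1) unfolding basis_of_def by auto
  have "card B \<le> card C"
    using card_le_rank[of B "insert e B"] indep_base[OF B] basis_of_card[OF C(1)] by auto
  then have card: "card C = card B"
    using indep_card_le[OF CB(2)] rank_ground[OF B] by simp
  then have base: "C \<in> bases M"
    using indep_card_rank_base[OF CB(2)] rank_ground[OF B] by simp
  have "card (insert e B - C) = 1"
    using CB e finite_base[OF B] card by (simp add: card_Diff_subset finite_indep)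
  then obtain f where f: "insert e B - C = {f}"
    using card_1_singletonE by blast
  then have "f \<in> B - B'" "C = insert e (B - {f})"
    using C(2) CB(1) by auto
  with base show ?thesis by blast
qed

lemma matroid_dual: "matroid (dual M)"
proof
  fix B B' e
  assume "B \<in> bases (dual M)" "B' \<in> bases (dual M)" and e: "e \<in> B - B'"
  then obtain D D' where D: "D \<in> bases M" "B = ground M - D" "D' \<in> bases M" "B' = ground M - D'"
    unfolding bases_dual by blast
  then obtain f where f: "f \<in> D - D'" "insert e (D - {f}) \<in> bases M"
    using bases_exchange_dual[of D D' e] e by blast
  have "insert f (B - {e}) = ground M - insert e (D - {f})"
    using D e f(1) bases_subset[OF D(1)] by blast
  then have "insert f (B - {e}) \<in> bases (dual M)"
    using f(2) unfolding bases_dual by blast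
  moreover have "f \<in> B' - B"
    using D f(1) bases_subset[OF D(1)] by blast
  ultimately show "\<exists>f \<in> B' - B. insert f (B - {e}) \<in> bases (dual M)" by blast
qed (use finite_ground bases_nonempty in \<open>auto simp: bases_dual\<close>)

lemma dual_dual: "dual (dual M) = M"
proof -
  have "(\<lambda>B. ground M - (ground M - B)) ` bases M = (\<lambda>B. B) ` bases M"
    using bases_subset by (intro image_cong) auto
  then have "bases (dual (dual M)) = bases M"
    by (simp add: matroid.bases_dual[OF matroid_dual] bases_dual image_image)
  then show ?thesis
    by (simp add: matroid_struct.equality matroid.ground_dual[OF matroid_dual])
qed

text \<open>With \<open>card_base_Int_le_rank\<close> this presents the rank of \<open>A\<close> as
  the maximum of \<open>card (A \<inter> B)\<close> over all bases, a form that passes well to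
  complements.\<close>

lemma rank_base_witness: "\<exists>B \<in> bases M. rank M A = card (A \<inter> B)"
proof -
  obtain I where I: "I \<subseteq> A" "indep M I" "rank M A = card I"
    using rank_witness by blast
  then obtain B where B: "B \<in> bases M" "I \<subseteq> B"
    unfolding indep_def by blast
  have "card I \<le> card (A \<inter> B)"
    using I B finite_base by (intro card_mono) auto
  moreover have "card (A \<inter> B) \<le> rank M A"
    using indep_subset[OF indep_base[OF B(1)]] by (intro card_le_rank) auto
  ultimately have "rank M A = card (A \<inter> B)" using I(3) by simp
  then show ?thesis using B(1) by blast
qed

lemma card_base_Int_le_rank: "B \<in> bases M \<Longrightarrow> card (A \<inter> B) \<le> rank M A"
  using indep_subset[OF indep_base] by (intro card_le_rank) auto

text \<open>The usual formula for the dual rank, arranged to avoid subtraction. By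
  \<open>split\<close>, the sizes of \<open>A \<inter> B\<close> and of its counterpart for the
  complements differ by a constant independent of \<open>B\<close>, so their maxima do too.\<close>

lemma rank_dual:
  assumes A: "A \<subseteq> ground M"
  shows "rank (dual M) (ground M - A) + rank M (ground M) = card (ground M - A) + rank M A"
proof -
  have split: "card ((ground M - A) \<inter> (ground M - B)) + rank M (ground M)
      = card (ground M - A) + card (A \<inter> B)" if B: "B \<in> bases M" for B
  proof -
    have "card (ground M - A) = card ((ground M - A) \<inter> (ground M - B)) + card (B - A)"
      using finite_ground bases_subset[OF B]
      by (subst card_Un_disjoint[symmetric]) (auto intro: finite_subset arg_cong[where f = card])
    moreover have "card B = card (B - A) + card (A \<inter> B)"
      using finite_base[OF B]
      by (subst card_Un_disjoint[symmetric]) (auto intro: arg_cong[where f = card])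
    ultimately show ?thesis using rank_ground[OF B] by simp
  qed
  obtain B where B: "B \<in> bases M" "rank M A = card (A \<inter> B)"
    using rank_base_witness by blast
  obtain D where D: "D \<in> bases M"
    "rank (dual M) (ground M - A) = card ((ground M - A) \<inter> (ground M - D))"
    using matroid.rank_base_witness[OF matroid_dual] unfolding bases_dual by blast
  have "card ((ground M - A) \<inter> (ground M - B)) \<le> rank (dual M) (ground M - A)"
    using matroid.card_base_Int_le_rank[OF matroid_dual] B(1) unfolding bases_dual by blast
  then show ?thesis
    using split[OF B(1)] split[OF D(1)] B(2) D(2) card_base_Int_le_rank[OF D(1), of A] by linarith
qed

end

text \<open>Augmenting \<open>B - {e}\<close> from \<open>B'\<close> gives an independent set of
  full size, hence a base. This suits the free extension, whose independent sets are easier to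
  handle than its bases.\<close>

lemma matroid_if_augment:
  assumes "finite (ground M)" "\<And>B. B \<in> bases M \<Longrightarrow> B \<subseteq> ground M" "bases M \<noteq> {}"
    and card: "\<And>B. B \<in> bases M \<Longrightarrow> card B = r"
    and augment: "\<And>I J. indep M I \<Longrightarrow> indep M J \<Longrightarrow> card I < card J
      \<Longrightarrow> \<exists>e \<in> J - I. indep M (insert e I)"
  shows "matroid M"
proof
  fix B B' e
  assume B: "B \<in> bases M" and B': "B' \<in> bases M" and e: "e \<in> B - B'"
  have fin: "finite C" if "C \<in> bases M" for C
    using assms(1,2) that finite_subset by blast
  have "indep M (B - {e})" "indep M B'"
    using B B' unfolding indep_def by blast+
  moreover have "card (B - {e}) < card B'"
    using e fin[OF B] card[OF B] card[OF B'] card_Diff1_less[of B e] by auto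
  ultimately obtain f where f: "f \<in> B' - (B - {e})" "indep M (insert f (B - {e}))"
    using augment by blast
  then have fB: "f \<in> B' - B" using e by blast
  obtain C where C: "C \<in> bases M" "insert f (B - {e}) \<subseteq> C"
    using f(2) unfolding indep_def by blast
  have "card (insert f (B - {e})) = card B"
    using e fB fin[OF B] card_Suc_Diff1[of B e] by simp
  then have "insert f (B - {e}) = C"
    using C fin card[OF B] card[OF C(1)] by (intro card_subset_eq) auto
  with C(1) fB show "\<exists>f \<in> B' - B. insert f (B - {e}) \<in> bases M" by blast
qed (use assms in auto)

section \<open>The free extension\<close>

context matroid
begin

lemma ground_free_extension [simp]: "ground (free_extension M x) = insert x (ground M)"
  by (simp add: free_extension_def)

lemma bases_free_extension:
  "bases (free_extension M x) = bases M \<union> {insert x B |B F. copoint M F \<and> basis_of M F B}"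
  by (simp add: free_extension_def)

text \<open>Removing from a base above \<open>I\<close> one element outside \<open>I\<close> leaves
  an independent set \<open>B\<close> of corank one; the copoint is the closure of
  \<open>B\<close>.\<close>

lemma indep_card_less_copoint:
  assumes I: "indep M I" and less: "card I < rank M (ground M)"
  shows "\<exists>F B. copoint M F \<and> basis_of M F B \<and> I \<subseteq> B"
proof -
  obtain C where C: "C \<in> bases M" "I \<subseteq> C"
    using I unfolding indep_def by blast
  then have "I \<noteq> C" using less rank_ground by auto
  then obtain e where e: "e \<in> C" "e \<notin> I" using C(2) by blast
  define B where "B = C - {e}"
  have B: "indep M B" "I \<subseteq> B" "card B + 1 = rank M (ground M)"
    using indep_subset[OF indep_base[OF C(1)]] C e rank_ground[OF C(1)] finite_base[OF C(1)]
      card_Suc_Diff1[of C e]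
    by (auto simp: B_def)
  have rB: "rank M B = card B"
  proof (rule antisym)
    obtain J where "J \<subseteq> B" "rank M B = card J" using rank_witness by blast
    then show "rank M B \<le> card B" using card_mono finite_indep[OF B(1)] by metis
  qed (use B card_le_rank in auto)
  \<comment> \<open>The closure of \<open>B\<close> is obtained as a maximal superset of the same
    rank; maximality is exactly what makes it a flat.\<close>
  let ?S = "{F. F \<subseteq> ground M \<and> B \<subseteq> F \<and> rank M F = card B}"
  have "finite ?S" using finite_ground by simp
  moreover have "?S \<noteq> {}" using indep_subset_ground[OF B(1)] rB by blast
  ultimately obtain F where F: "F \<in> ?S" and max: "\<forall>F' \<in> ?S. F \<subseteq> F' \<longrightarrow> F = F'"
    using finite_has_maximal[of ?S] by blast
  have "rank M F < rank M (insert e F)" if "e \<in> ground M - F" for e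
  proof -
    have "rank M (insert e F) \<noteq> card B"
      using max F that by blast
    then show ?thesis using rank_mono[OF subset_insertI, of F e] F by auto
  qed
  then have "copoint M F"
    using F B(3) unfolding copoint_def flat_def by auto
  moreover have "basis_of M F B"
    unfolding basis_of_def
  proof (intro conjI allI impI)
    fix J assume J: "J \<subseteq> F \<and> indep M J \<and> B \<subseteq> J"
    then have "card J \<le> card B" using card_le_rank[of J F] F by auto
    then show "J = B" using J finite_indep card_seteq by metis
  qed (use F B in auto)
  ultimately show ?thesis using B(2) by blast
qed

text \<open>The subsets of bases of copoints are exactly the independent sets that are not bases. In
  rank 0 there are no copoints and no cardinality is below the rank, so the second equivalence still
  holds.\<close>

lemma indep_free_extension:
  assumes "x \<notin> ground M" "x \<notin> I"
  shows "indep (free_extension M x) I \<longleftrightarrow> indep M I" (is ?old)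
    and "indep (free_extension M x) (insert x I) \<longleftrightarrow> indep M I \<and> card I < rank M (ground M)" (is ?new)
proof -
  have "indep M I" if B: "B \<in> bases (free_extension M x)" "I \<subseteq> B" for B
  proof (cases "B \<in> bases M")
    case True
    then show ?thesis using B(2) unfolding indep_def by blast
  next
    case False
    then obtain C where C: "B = insert x C" "indep M C"
      using B(1) by (auto simp: bases_free_extension basis_of_def)
    then have "I \<subseteq> C" using assms(2) B(2) by blast
    then show ?thesis by (rule indep_subset[OF C(2)])
  qed
  then show ?old
    unfolding indep_def[of "free_extension M x"] by (auto simp: indep_def bases_free_extension)
  have "indep (free_extension M x) (insert x I)
      \<longleftrightarrow> (\<exists>F B. copoint M F \<and> basis_of M F B \<and> I \<subseteq> B)"
    using assms bases_subset unfolding indep_def bases_free_extension by blast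
  moreover have "indep M I \<and> card I < rank M (ground M)"
    if "copoint M F" "basis_of M F B" "I \<subseteq> B" for F B
  proof -
    have B: "indep M B" using that(2) unfolding basis_of_def by blast
    moreover have "card I \<le> card B" using card_mono[OF finite_indep[OF B] that(3)] .
    ultimately show ?thesis
      using that basis_of_card[OF that(2)] indep_subset unfolding copoint_def by fastforce
  qed
  ultimately show ?new
    using indep_card_less_copoint by blast
qed

lemma matroid_free_extension:
  assumes x: "x \<notin> ground M"
  shows "matroid (free_extension M x)"
proof (rule matroid_if_augment[where r = "rank M (ground M)"])
  let ?N = "free_extension M x"
  show "finite (ground ?N)" "bases ?N \<noteq> {}"
    using finite_ground bases_nonempty by (auto simp: bases_free_extension)
  fix B assume "B \<in> bases ?N"
  then consider "B \<in> bases M" | F C where "copoint M F" "basis_of M F C" "B = insert x C"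
    unfolding bases_free_extension by blast
  then have "B \<subseteq> ground ?N \<and> card B = rank M (ground M)"
  proof cases
    case 1
    then show ?thesis using bases_subset rank_ground by auto
  next
    case 2
    then have C: "indep M C" "card C + 1 = rank M (ground M)"
      using basis_of_card unfolding copoint_def basis_of_def by auto
    moreover have "C \<subseteq> ground M" "x \<notin> C"
      using x indep_subset_ground[OF C(1)] by auto
    ultimately show ?thesis
      using 2(3) finite_indep[OF C(1)] by auto
  qed
  then show "B \<subseteq> ground ?N" "card B = rank M (ground M)" by auto
next
  let ?N = "free_extension M x"
  note indep_iff = indep_free_extension[OF x]
  fix I J assume I: "indep ?N I" and J: "indep ?N J" and less: "card I < card J"
  define I' where "I' = I - {x}"
  define J' where "J' = J - {x}"
  have I': "indep M I'" and J': "indep M J'"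
    using indep_iff[of I'] indep_iff[of J'] I J unfolding I'_def J'_def
    by (metis Diff_iff Diff_insert_absorb insertI1 insert_Diff_single insert_absorb)+
  \<comment> \<open>This bound gives \<open>card I\<close> below the rank, which is the condition
    for adding \<open>x\<close> to \<open>I\<close>.\<close>
  have J_le: "card J \<le> rank M (ground M)"
  proof (cases "x \<in> J")
    case True
    then have "J = insert x J'" "x \<notin> J'" by (auto simp: J'_def)
    then show ?thesis using J indep_iff(2)[of J'] finite_indep[OF J'] by auto
  next
    case False
    then show ?thesis using J indep_iff(1)[of J] indep_card_le by auto
  qed
  show "\<exists>e \<in> J - I. indep ?N (insert e I)"
  proof (cases "x \<in> J - I")
    case True
    then have "indep ?N (insert x I)"
      using I indep_iff[of I] less J_le by auto
    with True show ?thesis by blast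
  next
    case nx: False
    have cI: "card I = card I' + (if x \<in> I then 1 else 0)"
      using finite_indep[OF I'] card_Suc_Diff1[of I x] unfolding I'_def by auto
    have cJ: "card J = card J' + (if x \<in> J then 1 else 0)"
      using finite_indep[OF J'] card_Suc_Diff1[of J x] unfolding J'_def by auto
    \<comment> \<open>Here \<open>x \<in> J\<close> forces \<open>x \<in> I\<close>, so removing
      \<open>x\<close> shrinks \<open>I\<close> at least as much as \<open>J\<close>.\<close>
    have "card I' < card J'"
      using less nx cI cJ by (auto split: if_splits)
    then obtain e where e: "e \<in> J' - I'" "indep M (insert e I')"
      using indep_augment[OF I' J'] by blast
    then have ex: "x \<notin> insert e I'" by (auto simp: I'_def J'_def)
    have "indep ?N (insert e I)"
    proof (cases "x \<in> I")
      case True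
      then have "insert e I = insert x (insert e I')" by (auto simp: I'_def)
      moreover have "card (insert e I') < rank M (ground M)"
        using e finite_indep[OF I'] cI True less J_le by simp
      ultimately show ?thesis using indep_iff(2)[OF ex] e(2) by simp
    next
      case False
      then have "insert e I = insert e I'" by (auto simp: I'_def)
      then show ?thesis using indep_iff(1)[OF ex] e(2) by simp
    qed
    moreover have "e \<in> J - I" using e by (auto simp: I'_def J'_def)
    ultimately show ?thesis by blast
  qed
qed

text \<open>A maximum independent subset of \<open>A\<close> can be enlarged by \<open>x\<close>
  unless it is already a base.\<close>

lemma rank_free_extension:
  assumes x: "x \<notin> ground M" and A: "x \<notin> A"
  shows "rank (free_extension M x) A = rank M A"
    and "rank (free_extension M x) (insert x A) = min (rank M A + 1) (rank M (ground M))"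
proof -
  let ?N = "free_extension M x"
  interpret N: matroid ?N by (rule matroid_free_extension[OF x])
  note indep_iff = indep_free_extension[OF x]
  have "{card I |I. I \<subseteq> A \<and> indep ?N I} = {card I |I. I \<subseteq> A \<and> indep M I}"
    using A indep_iff(1) by (metis subsetD)
  then show "rank ?N A = rank M A"
    by (simp add: rank_def)
  obtain I where I: "I \<subseteq> A" "indep M I" "rank M A = card I"
    using rank_witness by blast
  have xI: "x \<notin> I" using I(1) A by blast
  have "min (rank M A + 1) (rank M (ground M)) \<le> rank ?N (insert x A)"
  proof (cases "card I < rank M (ground M)")
    case True
    then have "indep ?N (insert x I)" using indep_iff(2)[OF xI] I(2) by simp
    then have "card (insert x I) \<le> rank ?N (insert x A)"
      using I(1) by (intro N.card_le_rank) auto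
    then show ?thesis using xI finite_indep[OF I(2)] I(3) by simp
  next
    case False
    have "card I \<le> rank ?N (insert x A)"
      using I indep_iff(1)[OF xI] by (intro N.card_le_rank) auto
    then show ?thesis using False by simp
  qed
  moreover have "rank ?N (insert x A) \<le> min (rank M A + 1) (rank M (ground M))"
  proof -
    obtain J where J: "J \<subseteq> insert x A" "indep ?N J" "rank ?N (insert x A) = card J"
      using N.rank_witness by blast
    show ?thesis
    proof (cases "x \<in> J")
      case True
      then obtain J' where J': "J = insert x J'" "x \<notin> J'" by (meson mk_disjoint_insert)
      then have "indep M J'" "card J' < rank M (ground M)" using J(2) indep_iff(2) by auto
      moreover have "J' \<subseteq> A" using J(1) J' by blast
      ultimately show ?thesis
        using J(3) J' card_le_rank[of J' A] finite_indep[of J'] by simp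
    next
      case False
      then have "indep M J" "J \<subseteq> A" using J(1,2) indep_iff(1) by auto
      then show ?thesis
        using J(3) card_le_rank[of J A] indep_card_le[of J] by simp
    qed
  qed
  ultimately show "rank ?N (insert x A) = min (rank M A + 1) (rank M (ground M))"
    by (rule antisym[rotated])
qed

end

section \<open>Rank sequences\<close>

lemma length_rank_sequence [simp]: "length (rank_sequence M \<pi>) = length \<pi>"
  by (simp add: rank_sequence_def)

text \<open>Partial sums of a rank sequence are ranks of initial segments, so comparing them avoids
  handling differences of ranks entry by entry.\<close>

lemma list_eq_if_sum_list_take_eq:
  fixes xs ys :: "nat list"
  assumes "length xs = length ys"
    and "\<And>i. i \<le> length xs \<Longrightarrow> sum_list (take i xs) = sum_list (take i ys)"
  shows "xs = ys"
proof (rule nth_equalityI)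
  fix i assume i: "i < length xs"
  then show "xs ! i = ys ! i"
    using assms(1) assms(2)[of i] assms(2)[of "Suc i"] by (simp add: take_Suc_conv_app_nth)
qed (rule assms(1))

lemma lower_append_Cons:
  assumes "1 \<notin> set v"
  shows "lower (u @ 1 # v) = u @ 0 # v"
proof -
  have "Max {i. i < length (u @ 1 # v) \<and> (u @ 1 # v) ! i = 1} = length u"
  proof (rule Max_eqI)
    fix i assume i: "i \<in> {i. i < length (u @ 1 # v) \<and> (u @ 1 # v) ! i = 1}"
    show "i \<le> length u"
    proof (rule ccontr)
      assume "\<not> i \<le> length u"
      then obtain k where "i = length u + Suc k"
        by (metis add_Suc_right less_imp_Suc_add not_le)
      then have "k < length v" "v ! k = 1" using i by (auto simp: nth_append)
      then show False using assms nth_mem by metis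
    qed
  qed auto
  then show ?thesis unfolding lower_def by simp
qed

lemma raise_append_Cons:
  assumes "0 \<notin> set u"
  shows "raise (u @ 0 # v) = u @ 1 # v"
proof -
  have "Min {i. i < length (u @ 0 # v) \<and> (u @ 0 # v) ! i = 0} = length u"
  proof (rule Min_eqI)
    fix i assume i: "i \<in> {i. i < length (u @ 0 # v) \<and> (u @ 0 # v) ! i = 0}"
    show "length u \<le> i"
    proof (rule ccontr)
      assume "\<not> length u \<le> i"
      then have "i < length u" "u ! i = 0" using i by (auto simp: nth_append)
      then show False using assms nth_mem by metis
    qed
  qed auto
  then show ?thesis unfolding raise_def by simp
qed

text \<open>Before the right-most 1 the partial sums are at most \<open>r\<close> and stay
  unchanged; from it on they equal \<open>r + 1\<close> and drop to \<open>r\<close>.\<close>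

lemma sum_list_take_lower:
  assumes "set s \<subseteq> {0, 1}" "sum_list s = r + 1"
  shows "sum_list (take i (lower s)) = min (sum_list (take i s)) r"
proof -
  \<comment> \<open>The positive sum supplies the 1 that \<open>lower\<close> replaces.\<close>
  have "1 \<in> set s"
  proof (rule ccontr)
    assume "1 \<notin> set s"
    then have "\<forall>a \<in> set s. a = 0" using assms(1) by auto
    then have "sum_list s = 0" by (simp add: sum_list_eq_0_iff)
    then show False using assms(2) by simp
  qed
  then obtain u v where s: "s = u @ 1 # v" "1 \<notin> set v"
    using split_list_last by metis
  then have v: "\<forall>a \<in> set v. a = 0" using assms(1) by auto
  then have "\<forall>a \<in> set (take k v). a = 0" for k using in_set_takeD by fast
  then have v0: "sum_list (take k v) = 0" for k by (simp add: sum_list_eq_0_iff)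
  have u: "sum_list u = r" using assms(2) v0[of "length v"] s(1) by (simp del: sum_list_eq_0_iff)
  have "sum_list (take i u) \<le> r"
    using u sum_list_append[of "take i u" "drop i u"] by simp
  then show ?thesis
    using s(1) v0 u lower_append_Cons[OF s(2), of u]
    by (cases "i \<le> length u") (auto simp: take_Cons' simp del: One_nat_def sum_list_eq_0_iff)
qed

text \<open>The effect of duality on rank sequences. On entries 0 and 1 the natural subtraction is
  genuine complementation.\<close>

definition complement_rev :: "nat list \<Rightarrow> nat list" where
  "complement_rev s = rev (map (\<lambda>a. 1 - a) s)"

text \<open>Reversing and complementing turns the right-most 1 into the left-most 0.\<close>

lemma complement_rev_lower:
  assumes "set s \<subseteq> {0, 1}" "1 \<in> set s"
  shows "complement_rev (lower s) = raise (complement_rev s)"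
proof -
  obtain u v where s: "s = u @ 1 # v" "1 \<notin> set v"
    using assms(2) split_list_last by metis
  then have "set v \<subseteq> {0}" using assms(1) by auto
  then have "0 \<notin> set (complement_rev v)" by (auto simp: complement_rev_def)
  then show ?thesis
    using s(1) lower_append_Cons[OF s(2), of u]
      raise_append_Cons[of "complement_rev v" "complement_rev u"]
    by (simp add: complement_rev_def)
qed

text \<open>After reversal the entries preceding the new one are those that followed it, and there
  are \<open>length s - j\<close> of them.\<close>

lemma complement_rev_insert_after:
  assumes "j \<le> length s"
  shows "complement_rev (insert_after j 1 s) = insert_after (length s - j) 0 (complement_rev s)"
  using assms
  by (simp add: complement_rev_def insert_after_def take_map drop_map rev_map[symmetric] take_rev drop_rev)

section \<open>Rank sequences of the free extension and of the dual\<close>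

context matroid
begin

text \<open>The sum telescopes: monotonicity of the rank makes the natural subtractions exact, and
  the empty set has rank 0.\<close>

lemma sum_list_take_rank_sequence:
  "i \<le> length \<pi> \<Longrightarrow> sum_list (take i (rank_sequence M \<pi>)) = rank M (set (take i \<pi>))"
proof (induction i)
  case 0
  then show ?case by (simp add: rank_empty)
next
  case (Suc i)
  have "rank M (set (take i \<pi>)) \<le> rank M (set (take (Suc i) \<pi>))"
    by (intro rank_mono set_take_subset_set_take) simp
  then show ?case
    using Suc by (simp add: take_Suc_conv_app_nth[of i "rank_sequence M \<pi>"])
      (simp add: rank_sequence_def)
qed

lemma set_rank_sequence:
  "\<pi> \<in> permutations_of_set (ground M) \<Longrightarrow> set (rank_sequence M \<pi>) \<subseteq> {0, 1}"
  using rank_sequence_in_nr_sequences by (auto simp: nr_sequences_def)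

lemma rank_sequence_free_extension:
  assumes x: "x \<notin> ground M" and \<pi>: "\<pi> \<in> permutations_of_set (ground M)" and j: "j \<le> length \<pi>"
  shows "rank_sequence (free_extension M x) (take j \<pi> @ x # drop j \<pi>)
    = lower (insert_after j 1 (rank_sequence M \<pi>))"
proof (rule list_eq_if_sum_list_take_eq)
  let ?s = "rank_sequence M \<pi>" and ?\<rho> = "take j \<pi> @ x # drop j \<pi>"
  interpret N: matroid "free_extension M x" by (rule matroid_free_extension[OF x])
  have set: "set \<pi> = ground M" using \<pi> by (simp add: permutations_of_setD)
  have sums: "sum_list (take i ?s) = rank M (set (take i \<pi>))" if "i \<le> length \<pi>" for i
    using sum_list_take_rank_sequence that by simp
  show "length (rank_sequence (free_extension M x) ?\<rho>) = length (lower (insert_after j 1 ?s))"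
    using j by (simp add: lower_def insert_after_def)
  fix i assume "i \<le> length (rank_sequence (free_extension M x) ?\<rho>)"
  then have i: "i \<le> Suc (length \<pi>)" using j by simp
  \<comment> \<open>The inserted 1 exceeds the rank by one, so \<open>lower\<close> truncates the
    partial sums at the rank of \<open>M\<close>.\<close>
  have "sum_list (insert_after j 1 ?s) = rank M (ground M) + 1"
    using sums[of "length \<pi>"] set sum_list_append[of "take j ?s" "drop j ?s"]
    by (simp add: insert_after_def)
  moreover have "set (insert_after j 1 ?s) \<subseteq> {0, 1}"
    using set_rank_sequence[OF \<pi>] by (auto simp: insert_after_def dest: in_set_takeD in_set_dropD)
  ultimately have lower: "sum_list (take i (lower (insert_after j 1 ?s)))
      = min (sum_list (take i (insert_after j 1 ?s))) (rank M (ground M))"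
    using sum_list_take_lower by blast
  have ext: "sum_list (take i (rank_sequence (free_extension M x) ?\<rho>))
      = rank (free_extension M x) (set (take i ?\<rho>))"
    using i j by (intro N.sum_list_take_rank_sequence) simp
  have nx: "x \<notin> set (take k \<pi>)" for k
    using x set by (auto dest: in_set_takeD)
  show "sum_list (take i (rank_sequence (free_extension M x) ?\<rho>))
      = sum_list (take i (lower (insert_after j 1 ?s)))"
  proof (cases "i \<le> j")
    case True
    \<comment> \<open>Before \<open>x\<close> is reached the truncation has no effect.\<close>
    have "rank M (set (take i \<pi>)) \<le> rank M (ground M)"
      using set by (intro rank_mono) (auto dest: in_set_takeD)
    then show ?thesis
      using True j sums[of i]
      unfolding lower ext by (simp add: insert_after_def rank_free_extension(1)[OF x nx] min_absorb1)
  next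
    case False
    \<comment> \<open>The first \<open>i\<close> elements now consist of \<open>x\<close> and the
      first \<open>j + k\<close> elements of \<open>\<pi>\<close>.\<close>
    then obtain k where k: "i = Suc (j + k)"
      by (metis not_le less_imp_Suc_add)
    have "take i ?\<rho> = take j \<pi> @ x # take k (drop j \<pi>)"
      using k j by simp
    then have "set (take i ?\<rho>) = insert x (set (take (j + k) \<pi>))"
      by (simp add: take_add)
    moreover have "sum_list (take i (insert_after j 1 ?s)) = sum_list (take (j + k) ?s) + 1"
      using k j by (simp add: insert_after_def take_add)
    ultimately show ?thesis
      using sums[of "j + k"] k i unfolding lower ext by (simp add: rank_free_extension(2)[OF x nx])
  qed
qed

text \<open>An initial segment of the reversed ordering is the complement of an initial segment of
  \<open>\<pi>\<close>, so \<open>rank_dual\<close> expresses its dual rank; consecutive differences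
  then become complements of the original ones.\<close>

lemma rank_sequence_dual_rev:
  assumes \<pi>: "\<pi> \<in> permutations_of_set (ground M)"
  shows "rank_sequence (dual M) (rev \<pi>) = complement_rev (rank_sequence M \<pi>)"
proof (rule nth_equalityI)
  let ?R = "\<lambda>k. rank M (set (take k \<pi>))" and ?D = "\<lambda>k. rank (dual M) (set (take k (rev \<pi>)))"
  have set: "set \<pi> = ground M" and dist: "distinct \<pi>"
    using \<pi> by (auto dest: permutations_of_setD)
  have dual: "?D k + rank M (ground M) = k + ?R (length \<pi> - k)" if "k \<le> length \<pi>" for k
  proof -
    have "set (take k (rev \<pi>)) = set (drop (length \<pi> - k) \<pi>)"
      by (simp add: take_rev)
    also have "\<dots> = ground M - set (take (length \<pi> - k) \<pi>)"
      using set set_take_disj_set_drop_if_distinct[OF dist, of "length \<pi> - k" "length \<pi> - k"]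
        set_append[of "take (length \<pi> - k) \<pi>" "drop (length \<pi> - k) \<pi>"] by auto
    finally have eq: "set (take k (rev \<pi>)) = ground M - set (take (length \<pi> - k) \<pi>)" .
    have "card (set (take k (rev \<pi>))) = k"
      using dist that by (simp add: distinct_card)
    moreover have "set (take (length \<pi> - k) \<pi>) \<subseteq> ground M"
      using set by (auto dest: in_set_takeD)
    ultimately show ?thesis
      using rank_dual[of "set (take (length \<pi> - k) \<pi>)"] eq by simp
  qed
  show "length (rank_sequence (dual M) (rev \<pi>)) = length (complement_rev (rank_sequence M \<pi>))"
    by (simp add: complement_rev_def)
  fix i assume "i < length (rank_sequence (dual M) (rev \<pi>))"
  then have i: "i < length \<pi>" by simp
  then have Suc: "length \<pi> - i = Suc (length \<pi> - Suc i)" by simp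
  have "set (take (length \<pi> - i) \<pi>)
      = insert (\<pi> ! (length \<pi> - Suc i)) (set (take (length \<pi> - Suc i) \<pi>))"
    using i unfolding Suc by (simp add: take_Suc_conv_app_nth)
  \<comment> \<open>Both bounds are needed for the nested natural subtractions below to be
    exact.\<close>
  then have "?R (length \<pi> - Suc i) \<le> ?R (length \<pi> - i)"
    "?R (length \<pi> - i) \<le> ?R (length \<pi> - Suc i) + 1"
    using rank_insert_le rank_mono by (metis subset_insertI)+
  then have "?D (Suc i) - ?D i = 1 - (?R (length \<pi> - i) - ?R (length \<pi> - Suc i))"
    using dual[of i] dual[of "Suc i"] i by linarith
  then show "rank_sequence (dual M) (rev \<pi>) ! i = complement_rev (rank_sequence M \<pi>) ! i"
    using i Suc by (simp add: complement_rev_def rev_nth rank_sequence_def)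
qed

end

section \<open>Sums over permutations\<close>

text \<open>Every ordering of \<open>insert x A\<close> arises exactly once by inserting
  \<open>x\<close> into an ordering of \<open>A\<close>; the inverse deletes \<open>x\<close> and
  records how many elements preceded it.\<close>

lemma sum_permutations_of_set_insert:
  assumes "finite A" "x \<notin> A"
  shows "(\<Sum>\<rho> \<in> permutations_of_set (insert x A). g \<rho>)
    = (\<Sum>\<pi> \<in> permutations_of_set A. \<Sum>j \<le> card A. g (take j \<pi> @ x # drop j \<pi>))"
proof -
  have "(\<Sum>(\<pi>, j) \<in> permutations_of_set A \<times> {..card A}. g (take j \<pi> @ x # drop j \<pi>))
      = (\<Sum>\<rho> \<in> permutations_of_set (insert x A). g \<rho>)"
  proof (rule sum.reindex_bij_witness
      [where j = "\<lambda>(\<pi>, j). take j \<pi> @ x # drop j \<pi>"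
        and i = "\<lambda>\<rho>. (remove1 x \<rho>, length (takeWhile (\<lambda>y. y \<noteq> x) \<rho>))"])
    fix p assume "p \<in> permutations_of_set A \<times> {..card A}"
    then obtain \<pi> j where p: "p = (\<pi>, j)" and \<pi>: "set \<pi> = A" "distinct \<pi>" and "j \<le> card A"
      by (auto dest: permutations_of_setD)
    then have j: "j \<le> length \<pi>" using distinct_card by fastforce
    have nx: "x \<notin> set (take j \<pi>)" "x \<notin> set (drop j \<pi>)"
      using assms(2) \<pi>(1) by (auto dest: in_set_takeD in_set_dropD)
    have "takeWhile (\<lambda>y. y \<noteq> x) (take j \<pi> @ x # drop j \<pi>) = take j \<pi>"
      using nx by (subst takeWhile_append2) auto
    then show "(remove1 x (case p of (\<pi>, j) \<Rightarrow> take j \<pi> @ x # drop j \<pi>),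
        length (takeWhile (\<lambda>y. y \<noteq> x) (case p of (\<pi>, j) \<Rightarrow> take j \<pi> @ x # drop j \<pi>))) = p"
      using nx j p by (simp add: remove1_append)
    have "set (take j \<pi> @ x # drop j \<pi>) = insert x A"
      using \<pi>(1) set_append[of "take j \<pi>" "drop j \<pi>"] by auto
    moreover have "distinct (take j \<pi> @ x # drop j \<pi>)"
      using nx \<pi>(2) set_take_disj_set_drop_if_distinct[OF \<pi>(2), of j j] by auto
    ultimately show "(case p of (\<pi>, j) \<Rightarrow> take j \<pi> @ x # drop j \<pi>)
        \<in> permutations_of_set (insert x A)"
      using p by (simp add: permutations_of_setI)
  next
    fix \<rho> assume "\<rho> \<in> permutations_of_set (insert x A)"
    then have \<rho>: "set \<rho> = insert x A" "distinct \<rho>"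
      by (auto dest: permutations_of_setD)
    then obtain u v where uv: "\<rho> = u @ x # v" "x \<notin> set u"
      using split_list_first[of x \<rho>] by auto
    have take: "takeWhile (\<lambda>y. y \<noteq> x) \<rho> = u"
      using uv by (subst uv(1), subst takeWhile_append2) auto
    have rem: "remove1 x \<rho> = u @ v"
      using uv by (simp add: remove1_append)
    show "(case (remove1 x \<rho>, length (takeWhile (\<lambda>y. y \<noteq> x) \<rho>)) of
        (\<pi>, j) \<Rightarrow> take j \<pi> @ x # drop j \<pi>) = \<rho>"
      using take rem uv(1) by simp
    have "set (u @ v) = A" "distinct (u @ v)"
      using \<rho> uv assms(2) by auto
    moreover from this have "length u \<le> card A"
      using distinct_card[of "u @ v"] by simp
    ultimately show "(remove1 x \<rho>, length (takeWhile (\<lambda>y. y \<noteq> x) \<rho>))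
        \<in> permutations_of_set A \<times> {..card A}"
      using take rem by (simp add: permutations_of_setI)
  qed auto
  then show ?thesis by (simp add: sum.cartesian_product)
qed

lemma sum_permutations_of_set_rev:
  "(\<Sum>\<pi> \<in> permutations_of_set A. g (rev \<pi>)) = (\<Sum>\<pi> \<in> permutations_of_set A. g \<pi>)"
  by (rule sum.reindex_bij_witness[where i = rev and j = rev])
    (auto simp: permutations_of_set_def)

lemma specialize_G_invariant:
  "specialize f (G_invariant M) = (\<Sum>\<pi> \<in> permutations_of_set (ground M). f (rank_sequence M \<pi>))"
proof -
  interpret Vector_Spaces.linear scale scale "specialize f" by (rule linear_specialize)
  show ?thesis by (simp add: G_invariant_def sum specialize_symbol)
qed

text \<open>The separate leading term of the specialization is the insertion at position 0.\<close>

lemma sum_insert_after: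
  "g (a # s) + (\<Sum>j = 1..n. g (insert_after j a s)) = (\<Sum>j \<le> n. g (insert_after j a s))"
  by (simp add: atMost_atLeast0 sum.atLeast_Suc_atMost insert_after_def)

section \<open>Sums over orderings for the free extension and the free coextension\<close>

context matroid
begin

text \<open>Leaving \<open>g\<close> arbitrary allows both \<open>symbol\<close> and a composition
  with \<open>complement_rev\<close>, as the coextension requires.\<close>

lemma sum_rank_sequence_free_extension:
  assumes "x \<notin> ground M"
  shows "(\<Sum>\<rho> \<in> permutations_of_set (insert x (ground M)). g (rank_sequence (free_extension M x) \<rho>))
    = (\<Sum>\<pi> \<in> permutations_of_set (ground M). \<Sum>j \<le> card (ground M).
        g (lower (insert_after j 1 (rank_sequence M \<pi>))))"
  unfolding sum_permutations_of_set_insert[OF finite_ground assms]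
  using assms by (intro sum.cong refl arg_cong[where f = g] rank_sequence_free_extension)
    (auto simp: length_finite_permutations_of_set)

lemma sum_rank_sequence_dual:
  "(\<Sum>\<pi> \<in> permutations_of_set (ground M). g (rank_sequence (dual M) \<pi>))
    = (\<Sum>\<pi> \<in> permutations_of_set (ground M). g (complement_rev (rank_sequence M \<pi>)))"
  by (subst sum_permutations_of_set_rev[symmetric]) (simp add: rank_sequence_dual_rev)

text \<open>The result for the free extension of \<open>dual M\<close> is placed between two
  dualizations, each contributing one \<open>complement_rev\<close>.\<close>

lemma sum_rank_sequence_free_coextension:
  assumes x: "x \<notin> ground M"
  shows "(\<Sum>\<rho> \<in> permutations_of_set (insert x (ground M)). g (rank_sequence (free_coextension M x) \<rho>))
    = (\<Sum>\<pi> \<in> permutations_of_set (ground M). \<Sum>j \<le> card (ground M).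
        g (raise (insert_after j 0 (rank_sequence M \<pi>))))"
proof -
  let ?n = "card (ground M)"
  interpret D: matroid "dual M" by (rule matroid_dual)
  interpret N: matroid "free_extension (dual M) x"
    using x by (intro D.matroid_free_extension) simp
  have "(\<Sum>\<rho> \<in> permutations_of_set (insert x (ground M)). g (rank_sequence (free_coextension M x) \<rho>))
      = (\<Sum>\<rho> \<in> permutations_of_set (insert x (ground M)).
          g (complement_rev (rank_sequence (free_extension (dual M) x) \<rho>)))"
    using N.sum_rank_sequence_dual[of g] by (simp add: free_coextension_def)
  also have "\<dots> = (\<Sum>\<pi> \<in> permutations_of_set (ground M). \<Sum>j \<le> ?n.
      g (complement_rev (lower (insert_after j 1 (rank_sequence (dual M) \<pi>)))))"
    using D.sum_rank_sequence_free_extension[of x "\<lambda>s. g (complement_rev s)"] x by simp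
  also have "\<dots> = (\<Sum>\<pi> \<in> permutations_of_set (ground M). \<Sum>j \<le> ?n.
      g (raise (insert_after j 0 (complement_rev (rank_sequence (dual M) \<pi>)))))"
  proof (rule sum.cong[OF refl])
    fix \<pi> assume \<pi>: "\<pi> \<in> permutations_of_set (ground M)"
    let ?s = "rank_sequence (dual M) \<pi>"
    have len: "length ?s = ?n"
      using \<pi> by (simp add: length_finite_permutations_of_set)
    have "g (complement_rev (lower (insert_after j 1 ?s)))
        = g (raise (insert_after (?n - j) 0 (complement_rev ?s)))" if "j \<le> ?n" for j
    proof -
      have "set (insert_after j 1 ?s) \<subseteq> {0, 1}" "1 \<in> set (insert_after j 1 ?s)"
        using D.set_rank_sequence[of \<pi>] \<pi>
        by (auto simp: insert_after_def dest: in_set_takeD in_set_dropD)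
      then show ?thesis
        using that len by (simp only: complement_rev_lower complement_rev_insert_after)
    qed
    then have "(\<Sum>j \<le> ?n. g (complement_rev (lower (insert_after j 1 ?s))))
        = (\<Sum>j \<le> ?n. g (raise (insert_after (?n - j) 0 (complement_rev ?s))))"
      by (intro sum.cong) auto
    \<comment> \<open>All insertion positions are summed over, so the reflection of \<open>j\<close>
      to \<open>?n - j\<close> is harmless.\<close>
    also have "\<dots> = (\<Sum>j \<le> ?n. g (raise (insert_after j 0 (complement_rev ?s))))"
      unfolding atMost_atLeast0
      using sum.atLeastAtMost_rev[of "\<lambda>j. g (raise (insert_after j 0 (complement_rev ?s)))" 0 ?n]
      by simp
    finally show "(\<Sum>j \<le> ?n. g (complement_rev (lower (insert_after j 1 ?s))))
        = (\<Sum>j \<le> ?n. g (raise (insert_after j 0 (complement_rev ?s))))" .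
  qed
  \<comment> \<open>Duality is now applied to \<open>dual M\<close>, from right to left; since the
    double dual is \<open>M\<close>, this absorbs the remaining
    \<open>complement_rev\<close>.\<close>
  also have "\<dots> = (\<Sum>\<pi> \<in> permutations_of_set (ground M). \<Sum>j \<le> ?n.
      g (raise (insert_after j 0 (rank_sequence M \<pi>))))"
    using D.sum_rank_sequence_dual[of "\<lambda>s. \<Sum>j \<le> ?n. g (raise (insert_after j 0 s))"]
    by (simp add: dual_dual)
  finally show ?thesis .
qed

end

theorem proposition4p9:
  fixes M :: "'a matroid_struct" and x :: 'a and n :: nat
  assumes "matroid M"
    and "card (ground M) = n"
    and "x \<notin> ground M"
  shows "(G_invariant (free_extension M x) :: nat list \<Rightarrow>\<^sub>0 'k::field_char_0) =
           specialize
             (\<lambda>s. symbol (lower (1 # s)) + (\<Sum>j = 1..n. symbol (lower (insert_after j 1 s))))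
             (G_invariant M)
       \<and> (G_invariant (free_coextension M x) :: nat list \<Rightarrow>\<^sub>0 'k) =
           specialize
             (\<lambda>s. symbol (raise (0 # s)) + (\<Sum>j = 1..n. symbol (raise (insert_after j 0 s))))
             (G_invariant M)"
proof -
  interpret matroid M by (rule assms(1))
  have ground: "ground (free_coextension M x) = insert x (ground M)"
    by (simp add: free_coextension_def dual_def free_extension_def)
  show ?thesis
    unfolding specialize_G_invariant
      sum_insert_after[where g = "\<lambda>s. symbol (lower s)"]
      sum_insert_after[where g = "\<lambda>s. symbol (raise s)"]
    unfolding G_invariant_def ground ground_free_extension assms(2)[symmetric]
    by (intro conjI sum_rank_sequence_free_extension sum_rank_sequence_free_coextension assms(3))
qed

end
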